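(* There is no AR-Finsler manifold of (nontrivial) Randers type. That is, if $F=\alpha+\beta$ is a Randers metric on a smooth manifold $M$ with $\beta$ not identically zero, then $F$ is not an AR-Finsler metric.
   Context: $M$ is a smooth $n$-dimensional manifold with local coordinates $(x^i)$ and induced fibre coordinates $(y^i)$ on $TM$; $\dot{\partial}_i=\partial/\partial y^i$; the summation convention is used. A Finsler metric on $M$ is a map $F:TM\to[0,\infty)$ which is $C^\infty$ on $TM\setminus\{0\}$, positively homogeneous of degree one in $y$, and such that $g_{ij}(x,y):=\frac12\dot{\partial}_i\dot{\partial}_jF^2$ is positive definite at each point of $TM\setminus\{0\}$. A Finsler manifold $(M,F)$ is of Randers type (and $F$ is a Randers metric) if $F=\alpha+\beta$, where $\alpha=\sqrt{\alpha_{ij}(x)y^iy^j}$ is (the norm of) a Riemannian metric and $\beta=b_i(x)y^i$ is (given by) a $1$-form on $M$ with $\|\beta\|_\alpha=\sqrt{\alpha^{ij}(x)b_i(x)b_j(x)}<1$. "Rational in $y$" means: a quotient of two polynomials in the fibre coordinates $y$ whose coefficients are (smooth) functions of $x$. $F$ is an AR-Finsler (Almost Rational Finsler) metric, and $(M,F)$ an AR-Finsler manifold, if $g_{ij}(x,y)=\eta(x,y)\,a_{ij}(x,y)$ where (a) $\eta:TM\setminus\{0\}\to[0,\infty)$ is smooth; (b) $(a_{ij}(x,y))$ is a symmetric positive definite matrix with each $a_{ij}$ rational in $y$; (c) each product $\eta\,a_{ij}$ is positively homogeneous of degree zero in $y$.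
   Formalization: The manifold M is assumed to have dimension n ≥ 2; for n = 1 the claim is false, e.g. F = |y| + y/2 on the real line is a Randers metric with nonzero β and is an AR-Finsler metric (take η = g_11, a_11 = 1). *)

theory Defs
  imports "HOL-Analysis.Analysis"
begin

subsection \<open>Smooth maps between Euclidean spaces\<close>

text \<open>Meant for open \<open>S\<close>, where \<open>at x\<close> and \<open>at x within S\<close> agree.\<close>

primrec Ck_on :: "nat \<Rightarrow> 'a set \<Rightarrow> ('a::real_normed_vector \<Rightarrow> 'b::real_normed_vector) \<Rightarrow> bool" where
  "Ck_on 0 S f \<longleftrightarrow> continuous_on S f"
| "Ck_on (Suc k) S f \<longleftrightarrow> (\<forall>x\<in>S. f differentiable at x) \<and>
     (\<forall>v. Ck_on k S (\<lambda>x. frechet_derivative f (at x) v))"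

definition smooth_on :: "'a set \<Rightarrow> ('a::real_normed_vector \<Rightarrow> 'b::real_normed_vector) \<Rightarrow> bool" where
  "smooth_on S f \<longleftrightarrow> (\<forall>k. Ck_on k S f)"

subsection \<open>Smooth manifolds and their tangent bundles\<close>

text \<open>A chart is a pair of its domain and its coordinate map. The model space is
  \<open>real ^ 'n\<close>, so manifolds have dimension \<open>CARD('n)\<close>.\<close>

type_synonym ('m, 'n) chart = "'m set \<times> ('m \<Rightarrow> real ^ 'n)"

definition chart_image :: "('m, 'n::finite) chart \<Rightarrow> (real ^ 'n) set" where
  "chart_image c = snd c ` fst c"

definition chart_inv :: "('m, 'n::finite) chart \<Rightarrow> real ^ 'n \<Rightarrow> 'm" where
  "chart_inv c = inv_into (fst c) (snd c)"

definition transition :: "('m, 'n::finite) chart \<Rightarrow> ('m, 'n) chart \<Rightarrow> real ^ 'n \<Rightarrow> real ^ 'n" where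
  "transition c d = snd d \<circ> chart_inv c"

text \<open>The atlas need not be maximal; a maximal one is a special case.\<close>

definition smooth_manifold :: "'m topology \<Rightarrow> ('m, 'n::finite) chart set \<Rightarrow> bool" where
  "smooth_manifold M A \<longleftrightarrow>
     Hausdorff_space M \<and> second_countable M \<and>
     (\<Union>c\<in>A. fst c) = topspace M \<and>
     (\<forall>c\<in>A. openin M (fst c) \<and> open (chart_image c) \<and>
        homeomorphic_map (subtopology M (fst c)) (top_of_set (chart_image c)) (snd c)) \<and>
     (\<forall>c\<in>A. \<forall>d\<in>A. smooth_on (snd c ` (fst c \<inter> fst d)) (transition c d))"

text \<open>A tangent vector at \<open>p\<close> is given by its components in all charts around \<open>p\<close>, related by
  the Jacobians of the chart transitions. The components in the remaining charts are irrelevant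
  and set to 0.\<close>

definition tangent_space ::
    "('m, 'n::finite) chart set \<Rightarrow> 'm \<Rightarrow> (('m, 'n) chart \<Rightarrow> real ^ 'n) set" where
  "tangent_space A p = {v.
     (\<forall>c. \<not> (c \<in> A \<and> p \<in> fst c) \<longrightarrow> v c = 0) \<and>
     (\<forall>c\<in>A. \<forall>d\<in>A. p \<in> fst c \<inter> fst d \<longrightarrow>
        v d = frechet_derivative (transition c d) (at (snd c p)) (v c))}"

type_synonym ('m, 'n) tangent = "'m \<times> (('m, 'n) chart \<Rightarrow> real ^ 'n)"

definition tangent_bundle ::
    "'m topology \<Rightarrow> ('m, 'n::finite) chart set \<Rightarrow> ('m, 'n) tangent set" where
  "tangent_bundle M A = Sigma (topspace M) (tangent_space A)"

definition slit_tangent_bundle ::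
    "'m topology \<Rightarrow> ('m, 'n::finite) chart set \<Rightarrow> ('m, 'n) tangent set" where
  "slit_tangent_bundle M A = tangent_bundle M A - {v. snd v = (\<lambda>c. 0)}"

definition scale_tangent :: "real \<Rightarrow> ('m, 'n::finite) tangent \<Rightarrow> ('m, 'n) tangent" where
  "scale_tangent t v = (fst v, \<lambda>c. t *\<^sub>R snd v c)"

text \<open>The tangent vector with induced coordinates \<open>(x, y)\<close> in the chart \<open>c\<close>. Functions on the
  tangent bundle, or off its zero section, are represented by total functions, and their
  expression in the induced coordinates is obtained by composition with \<open>tangent_at A c\<close>.\<close>

definition tangent_at ::
    "('m, 'n::finite) chart set \<Rightarrow> ('m, 'n) chart \<Rightarrow> real ^ 'n \<Rightarrow> real ^ 'n \<Rightarrow> ('m, 'n) tangent" where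
  "tangent_at A c x y = (chart_inv c x, \<lambda>d.
     if d \<in> A \<and> chart_inv c x \<in> fst d then frechet_derivative (transition c d) (at x) y else 0)"

definition smooth_on_slit ::
    "('m, 'n::finite) chart set \<Rightarrow> (('m, 'n) tangent \<Rightarrow> real) \<Rightarrow> bool" where
  "smooth_on_slit A f \<longleftrightarrow>
     (\<forall>c\<in>A. smooth_on (chart_image c \<times> (- {0})) (\<lambda>(x, y). f (tangent_at A c x y)))"

subsection \<open>Finsler metrics\<close>

definition sym_pos_def :: "real ^ 'n ^ 'n \<Rightarrow> bool" where
  "sym_pos_def a \<longleftrightarrow> transpose a = a \<and> (\<forall>v. v \<noteq> 0 \<longrightarrow> v \<bullet> (a *v v) > 0)"

definition partial_deriv :: "'n \<Rightarrow> (real ^ 'n \<Rightarrow> real) \<Rightarrow> real ^ 'n::finite \<Rightarrow> real" where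
  "partial_deriv i h y = frechet_derivative h (at y) (axis i 1)"

definition fundamental_tensor ::
    "('m, 'n::finite) chart set \<Rightarrow> (('m, 'n) tangent \<Rightarrow> real) \<Rightarrow> ('m, 'n) chart \<Rightarrow>
     real ^ 'n \<Rightarrow> real ^ 'n \<Rightarrow> real ^ 'n ^ 'n" where
  "fundamental_tensor A F c x y = (\<chi> i j.
     1 / 2 * partial_deriv i (partial_deriv j (\<lambda>z. (F (tangent_at A c x z))\<^sup>2)) y)"

definition finsler_metric ::
    "'m topology \<Rightarrow> ('m, 'n::finite) chart set \<Rightarrow> (('m, 'n) tangent \<Rightarrow> real) \<Rightarrow> bool" where
  "finsler_metric M A F \<longleftrightarrow>
     (\<forall>v\<in>tangent_bundle M A. F v \<ge> 0) \<and>
     smooth_on_slit A F \<and>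
     (\<forall>v\<in>tangent_bundle M A. \<forall>t>0. F (scale_tangent t v) = t * F v) \<and>
     (\<forall>c\<in>A. \<forall>x\<in>chart_image c. \<forall>y. y \<noteq> 0 \<longrightarrow> sym_pos_def (fundamental_tensor A F c x y))"

subsection \<open>Randers metrics\<close>

text \<open>\<open>a\<close> is the coefficient matrix, in the chart \<open>c\<close>, of a Riemannian metric with norm \<open>\<alpha>\<close>.\<close>

definition riemannian_coeffs ::
    "('m, 'n::finite) chart set \<Rightarrow> ('m, 'n) chart \<Rightarrow> (('m, 'n) tangent \<Rightarrow> real) \<Rightarrow>
     (real ^ 'n \<Rightarrow> real ^ 'n ^ 'n) \<Rightarrow> bool" where
  "riemannian_coeffs A c \<alpha> a \<longleftrightarrow>
     (\<forall>i j. smooth_on (chart_image c) (\<lambda>x. a x $ i $ j)) \<and>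
     (\<forall>x\<in>chart_image c. sym_pos_def (a x)) \<and>
     (\<forall>x\<in>chart_image c. \<forall>y. \<alpha> (tangent_at A c x y) =
        sqrt (\<Sum>i\<in>UNIV. \<Sum>j\<in>UNIV. a x $ i $ j * y $ i * y $ j))"

definition one_form_coeffs ::
    "('m, 'n::finite) chart set \<Rightarrow> ('m, 'n) chart \<Rightarrow> (('m, 'n) tangent \<Rightarrow> real) \<Rightarrow>
     (real ^ 'n \<Rightarrow> real ^ 'n) \<Rightarrow> bool" where
  "one_form_coeffs A c \<beta> b \<longleftrightarrow>
     (\<forall>i. smooth_on (chart_image c) (\<lambda>x. b x $ i)) \<and>
     (\<forall>x\<in>chart_image c. \<forall>y. \<beta> (tangent_at A c x y) = (\<Sum>i\<in>UNIV. b x $ i * y $ i))"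

text \<open>The coefficients are determined by \<open>\<alpha>\<close> and \<open>\<beta>\<close>, so quantifying over them
  existentially or universally makes no difference to the norm condition.\<close>

definition randers_metric ::
    "'m topology \<Rightarrow> ('m, 'n::finite) chart set \<Rightarrow> (('m, 'n) tangent \<Rightarrow> real) \<Rightarrow>
     (('m, 'n) tangent \<Rightarrow> real) \<Rightarrow> (('m, 'n) tangent \<Rightarrow> real) \<Rightarrow> bool" where
  "randers_metric M A F \<alpha> \<beta> \<longleftrightarrow>
     finsler_metric M A F \<and>
     (\<forall>v\<in>tangent_bundle M A. F v = \<alpha> v + \<beta> v) \<and>
     (\<forall>c\<in>A. \<exists>a b. riemannian_coeffs A c \<alpha> a \<and> one_form_coeffs A c \<beta> b \<and>
        (\<forall>x\<in>chart_image c.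
           sqrt (\<Sum>i\<in>UNIV. \<Sum>j\<in>UNIV. matrix_inv (a x) $ i $ j * b x $ i * b x $ j) < 1))"

subsection \<open>Almost rational Finsler metrics\<close>

text \<open>The finite set \<open>K\<close> consists of the exponents of the monomials that may occur.\<close>

definition polynomial_in_fibre ::
    "(real ^ 'n) set \<Rightarrow> (real ^ 'n \<Rightarrow> real ^ 'n::finite \<Rightarrow> real) \<Rightarrow> bool" where
  "polynomial_in_fibre V P \<longleftrightarrow>
     (\<exists>(K :: ('n \<Rightarrow> nat) set) u. finite K \<and> (\<forall>k\<in>K. smooth_on V (u k)) \<and>
        (\<forall>x\<in>V. \<forall>y. P x y = (\<Sum>k\<in>K. u k x * (\<Prod>i\<in>UNIV. (y $ i) ^ k i))))"

definition rational_in_fibre ::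
    "(real ^ 'n) set \<Rightarrow> (real ^ 'n \<Rightarrow> real ^ 'n::finite \<Rightarrow> real) \<Rightarrow> bool" where
  "rational_in_fibre V f \<longleftrightarrow>
     (\<exists>P Q. polynomial_in_fibre V P \<and> polynomial_in_fibre V Q \<and>
        (\<forall>x\<in>V. \<forall>y. y \<noteq> 0 \<longrightarrow> Q x y \<noteq> 0 \<and> f x y = P x y / Q x y))"

definition ar_finsler_metric ::
    "'m topology \<Rightarrow> ('m, 'n::finite) chart set \<Rightarrow> (('m, 'n) tangent \<Rightarrow> real) \<Rightarrow> bool" where
  "ar_finsler_metric M A F \<longleftrightarrow>
     finsler_metric M A F \<and>
     (\<exists>\<eta>. (\<forall>v\<in>slit_tangent_bundle M A. \<eta> v \<ge> 0) \<and> smooth_on_slit A \<eta> \<and>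
       (\<forall>c\<in>A. \<exists>a :: real ^ 'n \<Rightarrow> real ^ 'n \<Rightarrow> real ^ 'n ^ 'n.
          (\<forall>x\<in>chart_image c. \<forall>y. y \<noteq> 0 \<longrightarrow>
             fundamental_tensor A F c x y = \<eta> (tangent_at A c x y) *\<^sub>R a x y \<and>
             sym_pos_def (a x y)) \<and>
          (\<forall>i j. rational_in_fibre (chart_image c) (\<lambda>x y. a x y $ i $ j)) \<and>
          (\<forall>i j. \<forall>x\<in>chart_image c. \<forall>y. y \<noteq> 0 \<longrightarrow> (\<forall>t>0.
             \<eta> (tangent_at A c x (t *\<^sub>R y)) * a x (t *\<^sub>R y) $ i $ j =
             \<eta> (tangent_at A c x y) * a x y $ i $ j))))"

end

theory Submission
  imports Defs
begin

text \<open>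
  Fix a point where \<open>\<beta> \<noteq> 0\<close>, let \<open>w\<close> be the \<open>\<alpha>\<close>-dual of \<open>\<beta>\<close>, choose \<open>e \<noteq> 0\<close> with \<open>\<beta>(e) = 0\<close>
  (here the dimension is at least 2), and put \<open>q = \<alpha>(e)\<^sup>2\<close>, \<open>m = \<beta>(w) = \<alpha>(w)\<^sup>2\<close>. Along the line
  \<open>y = e + t w\<close> one has \<open>\<alpha>\<^sup>2 = q + m t\<^sup>2\<close>, and the Hessian of \<open>F\<^sup>2 / 2\<close> gives
  \<open>g(e, e) = q (\<alpha>\<^sup>3 + m\<^sup>2 t\<^sup>3) / \<alpha>\<^sup>3\<close> and \<open>g(e, w) = q\<^sup>2 m / \<alpha>\<^sup>3\<close>. For an almost rational metric the
  factor \<open>\<eta>\<close> cancels in \<open>g(e, e) / g(e, w) = (\<alpha>\<^sup>3 + m\<^sup>2 t\<^sup>3) / (q m)\<close>, so this quotient is rational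
  in \<open>t\<close>; hence so is \<open>\<alpha> = \<surd>(q + m t\<^sup>2)\<close>, which contradicts the odd order of \<open>q + m t\<^sup>2\<close> at its
  complex roots.
\<close>

section \<open>Irrationality of the square root of a positive quadratic\<close>

lemma map_poly_of_real_mult:
  "map_poly of_real (p * q) =
    (map_poly of_real p * map_poly of_real q :: 'a :: {real_algebra_1, comm_ring_1} poly)"
  by (rule poly_eqI) (simp add: coeff_map_poly coeff_mult)

text \<open>Squaring gives \<open>Y * Y = X * X * [:q, 0, m:]\<close>. The quadratic has no real
  root, so orders are compared over the complex numbers: at a simple root of it the left side has
  even order and the right side odd order.\<close>

lemma sqrt_quadratic_not_rational:
  fixes X Y :: "real poly" and q m :: real
  assumes q: "q > 0" and m: "m > 0" and X: "X \<noteq> 0"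
    and eq: "\<And>t. sqrt (q + m * t\<^sup>2) * poly X t = poly Y t"
  shows False
proof -
  let ?c = "map_poly complex_of_real"
  \<comment> \<open>One of the two roots \<open>s\<close> and \<open>- s\<close> of
    \<open>q + m z^2\<close>.\<close>
  define s where "s = complex_of_real (sqrt (q / m)) * \<i>"
  have s2: "s * s = - of_real (q / m)"
  proof -
    have sq: "sqrt (q / m) * sqrt (q / m) = q / m"
      using q m by simp
    have "s * s = - (of_real (sqrt (q / m)) * of_real (sqrt (q / m)))"
      unfolding s_def by (rule complex_eqI) simp_all
    also have "\<dots> = - of_real (q / m)"
      by (simp only: of_real_mult[symmetric] sq)
    finally show ?thesis .
  qed
  have s0: "s \<noteq> 0"
    using q m by (simp add: s_def)
  have "poly (Y * Y) t = poly (X * X * [:q, 0, m:]) t" for t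
  proof -
    have "0 \<le> q + m * t\<^sup>2"
      using q m by simp
    then have "sqrt (q + m * t\<^sup>2) * sqrt (q + m * t\<^sup>2) = q + m * t\<^sup>2"
      by simp
    then have "poly Y t * poly Y t = (q + m * t\<^sup>2) * (poly X t * poly X t)"
      unfolding eq[symmetric] by (metis mult.assoc mult.left_commute)
    then show ?thesis
      by (simp add: algebra_simps power2_eq_square)
  qed
  \<comment> \<open>Agreement at every real \<open>t\<close> is equality of polynomials, which can
    be carried over to complex coefficients.\<close>
  then have YX: "Y * Y = X * X * [:q, 0, m:]"
    by (metis poly_eq_poly_eq_iff ext)
  have "?c [:q, 0, m:] = smult (of_real m) ([:- s, 1:] * [:s, 1:])"
    using s2 m by (simp add: map_poly_pCons)
  then have c: "?c Y * ?c Y = smult (of_real m) (?c X * ?c X * ([:- s, 1:] * [:s, 1:]))"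
    using YX by (metis map_poly_of_real_mult mult_smult_right)
  have cX: "?c X \<noteq> 0"
    using X by (simp add: map_poly_eq_0_iff)
  \<comment> \<open>As \<open>s \<noteq> 0\<close>, the roots \<open>s\<close> and
    \<open>- s\<close> differ, so the factor \<open>[:s, 1:]\<close> contributes nothing at
    \<open>s\<close>.\<close>
  have ord: "order s [:- s, 1:] = 1" "order s [:s, 1:] = 0"
    using order_power_n_n[of s 1] s0 by (auto intro!: order_0I)
  have nz: "?c X * ?c X * ([:- s, 1:] * [:s, 1:]) \<noteq> 0"
    using cX by (simp del: mult_pCons_left mult_pCons_right)
  have nzY: "?c Y * ?c Y \<noteq> 0"
    using nz m unfolding c by simp
  have "order s (?c Y * ?c Y) = 2 * order s (?c Y)"
    using order_mult[OF nzY] by simp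
  moreover have "order s (?c Y * ?c Y) = 2 * order s (?c X) + 1"
  proof -
    have "order s (?c Y * ?c Y) = order s (?c X * ?c X * ([:- s, 1:] * [:s, 1:]))"
      unfolding c using m by (simp add: order_smult del: mult_pCons_left mult_pCons_right)
    also have "\<dots> = order s (?c X * ?c X) + order s ([:- s, 1:] * [:s, 1:])"
      using order_mult[OF nz] .
    also have "order s ([:- s, 1:] * [:s, 1:]) = 1"
      using order_mult[of "[:- s, 1:]" "[:s, 1:]" s] ord
      by (simp del: mult_pCons_left mult_pCons_right)
    also have "order s (?c X * ?c X) = 2 * order s (?c X)"
      using order_mult[of "?c X" "?c X" s] cX by simp
    finally show ?thesis .
  qed
  ultimately show False
    by presburger
qed

section \<open>Restriction of fibrewise rational functions to lines\<close>

lemma polynomial_in_fibre_line: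
  fixes P :: "real ^ 'n::finite \<Rightarrow> real ^ 'n \<Rightarrow> real"
  assumes "polynomial_in_fibre V P" "x \<in> V"
  shows "\<exists>p. \<forall>t. P x (e + t *\<^sub>R w) = poly p t"
proof -
  obtain K :: "('n \<Rightarrow> nat) set" and u where
    P: "\<And>y. P x y = (\<Sum>k\<in>K. u k x * (\<Prod>i\<in>UNIV. (y $ i) ^ k i))"
    using assms unfolding polynomial_in_fibre_def by blast
  show ?thesis
    \<comment> \<open>With \<open>x\<close> fixed the coefficients are constants, and each
      coordinate of the line is a linear polynomial in \<open>t\<close>.\<close>
    by (rule exI[of _ "\<Sum>k\<in>K. smult (u k x) (\<Prod>i\<in>UNIV. [:e $ i, w $ i:] ^ k i)"])
      (simp add: P poly_sum poly_prod)
qed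

text \<open>The denominator has no real zero, so the quotient is genuine at every \<open>t\<close>
  and sums and products create no exceptional points.\<close>

definition rational_fun :: "(real \<Rightarrow> real) \<Rightarrow> bool" where
  "rational_fun f \<longleftrightarrow> (\<exists>p q. \<forall>t. poly q t \<noteq> 0 \<and> f t = poly p t / poly q t)"

lemma rational_fun_const: "rational_fun (\<lambda>_. c)"
  unfolding rational_fun_def by (rule exI[of _ "[:c:]"], rule exI[of _ 1]) simp

lemma rational_fun_add:
  assumes "rational_fun f" "rational_fun g"
  shows "rational_fun (\<lambda>t. f t + g t)"
proof -
  obtain p q r s where "\<And>t. poly q t \<noteq> 0 \<and> f t = poly p t / poly q t"
    "\<And>t. poly s t \<noteq> 0 \<and> g t = poly r t / poly s t"
    using assms unfolding rational_fun_def by blast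
  then show ?thesis
    unfolding rational_fun_def
    by (intro exI[of _ "p * s + r * q"] exI[of _ "q * s"]) (simp add: add_frac_eq)
qed

lemma rational_fun_mult:
  assumes "rational_fun f" "rational_fun g"
  shows "rational_fun (\<lambda>t. f t * g t)"
proof -
  obtain p q r s where "\<And>t. poly q t \<noteq> 0 \<and> f t = poly p t / poly q t"
    "\<And>t. poly s t \<noteq> 0 \<and> g t = poly r t / poly s t"
    using assms unfolding rational_fun_def by blast
  then show ?thesis
    unfolding rational_fun_def
    by (intro exI[of _ "p * r"] exI[of _ "q * s"]) simp
qed

lemma rational_fun_sum:
  assumes "\<And>i. i \<in> I \<Longrightarrow> rational_fun (f i)"
  shows "rational_fun (\<lambda>t. \<Sum>i\<in>I. f i t)"
  using assms
  by (induction I rule: infinite_finite_induct) (auto intro: rational_fun_const rational_fun_add)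

text \<open>The line has to miss the origin, because the denominator of a fibrewise rational
  function is controlled only for \<open>y \<noteq> 0\<close>.\<close>

lemma rational_in_fibre_line:
  assumes "rational_in_fibre V f" "x \<in> V" and "\<And>t. e + t *\<^sub>R w \<noteq> 0"
  shows "rational_fun (\<lambda>t. f x (e + t *\<^sub>R w))"
proof -
  obtain P Q where P: "polynomial_in_fibre V P" and Q: "polynomial_in_fibre V Q"
    and f: "\<And>y. y \<noteq> 0 \<Longrightarrow> Q x y \<noteq> 0 \<and> f x y = P x y / Q x y"
    using assms(1,2) unfolding rational_in_fibre_def by blast
  obtain p q where "\<And>t. P x (e + t *\<^sub>R w) = poly p t" "\<And>t. Q x (e + t *\<^sub>R w) = poly q t"
    using polynomial_in_fibre_line[OF P assms(2)] polynomial_in_fibre_line[OF Q assms(2)] by metis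
  with f assms(3) show ?thesis
    unfolding rational_fun_def by metis
qed

section \<open>Quadratic forms and the Hessian of a squared Randers norm\<close>

lemma inner_matrix_vector_mult:
  fixes a :: "real ^ 'n ^ 'm"
  shows "u \<bullet> (a *v v) = (\<Sum>i\<in>UNIV. \<Sum>j\<in>UNIV. a $ i $ j * u $ i * v $ j)"
  by (simp add: inner_vec_def matrix_vector_mult_def sum_distrib_left mult_ac)

lemma inner_matrix_vector_sym:
  fixes a :: "real ^ 'n ^ 'n"
  assumes "transpose a = a"
  shows "u \<bullet> (a *v v) = v \<bullet> (a *v u)"
  by (metis assms dot_lmul_matrix inner_commute transpose_matrix_vector)

text \<open>Positive definiteness makes the kernel trivial. This supplies the vector dual to a
  one-form.\<close>

lemma sym_pos_def_surj:
  fixes a :: "real ^ 'n ^ 'n"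
  assumes "sym_pos_def a"
  shows "\<exists>w. a *v w = b"
proof -
  have "a *v v = 0 \<Longrightarrow> v = 0" for v
    using assms unfolding sym_pos_def_def by force
  then have "invertible a"
    using invertible_left_inverse matrix_left_invertible_ker by blast
  then show ?thesis
    by (metis invertible_def matrix_vector_mul_assoc matrix_vector_mul_lid)
qed

lemma has_derivative_sqrt_quadratic_form:
  fixes a :: "real ^ 'n ^ 'n"
  assumes a: "sym_pos_def a" and "z \<noteq> 0"
  shows "((\<lambda>z. sqrt (z \<bullet> (a *v z))) has_derivative
    (\<lambda>v. v \<bullet> (a *v z) / sqrt (z \<bullet> (a *v z)))) (at z)"
proof -
  have pos: "z \<bullet> (a *v z) > 0"
    using a \<open>z \<noteq> 0\<close> by (simp add: sym_pos_def_def)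
  have "((\<lambda>z. z \<bullet> (a *v z)) has_derivative (\<lambda>v. z \<bullet> (a *v v) + v \<bullet> (a *v z))) (at z)"
    by (intro has_derivative_inner has_derivative_ident
        bounded_linear.has_derivative[OF matrix_vector_mul_bounded_linear])
  moreover have "z \<bullet> (a *v v) = v \<bullet> (a *v z)" for v
    using a by (intro inner_matrix_vector_sym) (simp add: sym_pos_def_def)
  ultimately have "((\<lambda>z. z \<bullet> (a *v z)) has_derivative (\<lambda>v. 2 * (v \<bullet> (a *v z)))) (at z)"
    by simp
  from has_derivative_real_sqrt[OF pos this] show ?thesis
    by (rule has_derivative_eq_rhs) (auto simp: fun_eq_iff divide_simps)
qed

text \<open>For f = \<open>N z + b \<bullet> z\<close>, half the Hessian of f^2 is f_i f_j + f f_ij.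
  The linear part drops out of f_ij, so the last bracket is the Hessian of \<open>N\<close>
  alone.\<close>

lemma randers_hessian_entry:
  fixes a :: "real ^ 'n ^ 'n" and b y :: "real ^ 'n"
  assumes a: "sym_pos_def a" and y: "y \<noteq> 0"
  defines "N \<equiv> \<lambda>z. sqrt (z \<bullet> (a *v z))"
  shows "1 / 2 * partial_deriv i (partial_deriv j (\<lambda>z. (N z + b \<bullet> z)\<^sup>2)) y =
    ((a *v y) $ i / N y + b $ i) * ((a *v y) $ j / N y + b $ j) +
    (N y + b \<bullet> y) * (a $ i $ j / N y - (a *v y) $ i * (a *v y) $ j / N y ^ 3)"
proof -
  have N: "(N has_derivative (\<lambda>v. v \<bullet> (a *v z) / N z)) (at z)" if "z \<noteq> 0" for z
    unfolding N_def using has_derivative_sqrt_quadratic_form[OF a that] .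
  have N0: "N z > 0" if "z \<noteq> 0" for z
    using a that by (simp add: sym_pos_def_def N_def)
  define D where "D = (\<lambda>z. 2 * (N z + b \<bullet> z) * ((a *v z) $ j / N z + b $ j))"
  have D: "partial_deriv j (\<lambda>z. (N z + b \<bullet> z)\<^sup>2) z = D z" if "z \<noteq> 0" for z
  proof -
    have "((\<lambda>z. (N z + b \<bullet> z)\<^sup>2) has_derivative
      (\<lambda>v. 2 * (N z + b \<bullet> z) * (v \<bullet> (a *v z) / N z + b \<bullet> v))) (at z)"
      using N0[OF that]
      by (auto intro!: derivative_eq_intros N[OF that] simp: fun_eq_iff field_simps)
    from frechet_derivative_at[OF this, symmetric] show ?thesis
      by (simp add: partial_deriv_def D_def inner_axis inner_axis')
  qed
  have aj: "((\<lambda>z. (a *v z) $ j) has_derivative (\<lambda>v. (a *v v) $ j)) (at y)"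
    by (intro bounded_linear.has_derivative[OF bounded_linear_vec_nth]
        bounded_linear.has_derivative[OF matrix_vector_mul_bounded_linear] has_derivative_ident)
  have "(D has_derivative (\<lambda>v.
      2 * (v \<bullet> (a *v y) / N y + b \<bullet> v) * ((a *v y) $ j / N y + b $ j) +
      2 * (N y + b \<bullet> y) *
        ((a *v v) $ j / N y - (v \<bullet> (a *v y)) * (a *v y) $ j / N y ^ 3))) (at y)"
    unfolding D_def
  proof (rule has_derivative_eq_rhs[OF has_derivative_mult])
    show "((\<lambda>z. 2 * (N z + b \<bullet> z)) has_derivative
      (\<lambda>v. 2 * (v \<bullet> (a *v y) / N y + b \<bullet> v))) (at y)"
      by (auto intro!: derivative_eq_intros N[OF y])
    show "((\<lambda>z. (a *v z) $ j / N z + b $ j) has_derivative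
      (\<lambda>v. ((a *v v) $ j * N y - (a *v y) $ j * (v \<bullet> (a *v y) / N y)) / (N y * N y) + 0)) (at y)"
      using N0[OF y]
      by (intro has_derivative_add has_derivative_const has_derivative_divide' aj N[OF y]) simp
  qed (use N0[OF y] in \<open>simp add: fun_eq_iff field_simps power3_eq_cube\<close>)
  \<comment> \<open>\<open>D\<close> is known to be the first partial derivative only off the
    origin; that set is open and contains \<open>y\<close>, which suffices for differentiating once
    more.\<close>
  then have "(partial_deriv j (\<lambda>z. (N z + b \<bullet> z)\<^sup>2) has_derivative (\<lambda>v.
      2 * (v \<bullet> (a *v y) / N y + b \<bullet> v) * ((a *v y) $ j / N y + b $ j) +
      2 * (N y + b \<bullet> y) *
        ((a *v v) $ j / N y - (v \<bullet> (a *v y)) * (a *v y) $ j / N y ^ 3))) (at y)"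
    by (rule has_derivative_transform_within_open[where s = "- {0}"]) (use y D in auto)
  from frechet_derivative_at[OF this, symmetric]
  have "partial_deriv i (partial_deriv j (\<lambda>z. (N z + b \<bullet> z)\<^sup>2)) y =
      2 * ((a *v y) $ i / N y + b $ i) * ((a *v y) $ j / N y + b $ j) +
      2 * (N y + b \<bullet> y) *
        (a $ j $ i / N y - (a *v y) $ i * (a *v y) $ j / N y ^ 3)"
    unfolding partial_deriv_def[of i]
    by (simp add: inner_axis inner_axis' matrix_vector_mul_component)
  \<comment> \<open>Differentiating component \<open>j\<close> in direction \<open>i\<close> yields
    the transposed entry.\<close>
  moreover have "a $ j $ i = a $ i $ j"
    using a unfolding sym_pos_def_def transpose_def by (metis vec_lambda_beta)
  ultimately show ?thesis
    by (simp only: mult.assoc flip: distrib_left) simp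
qed

text \<open>Contraction of the entry formula: applying the matrix to \<open>v\<close> leaves a
  combination of \<open>a *v y\<close>, \<open>b\<close> and \<open>a *v v\<close>, which is then
  paired with \<open>u\<close>.\<close>

lemma inner_randers_hessian:
  fixes a :: "real ^ 'n ^ 'n" and b y u v :: "real ^ 'n"
  assumes a: "sym_pos_def a" and y: "y \<noteq> 0"
  defines "N \<equiv> \<lambda>z. sqrt (z \<bullet> (a *v z))"
  shows "u \<bullet> ((\<chi> i j. 1 / 2 * partial_deriv i (partial_deriv j (\<lambda>z. (N z + b \<bullet> z)\<^sup>2)) y) *v v) =
    (u \<bullet> (a *v y) / N y + b \<bullet> u) * (v \<bullet> (a *v y) / N y + b \<bullet> v) +
    (N y + b \<bullet> y) * (u \<bullet> (a *v v) / N y - (u \<bullet> (a *v y)) * (v \<bullet> (a *v y)) / N y ^ 3)"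
proof -
  let ?l = "a *v y"
    and ?g = "(\<chi> i j. 1 / 2 * partial_deriv i (partial_deriv j (\<lambda>z. (N z + b \<bullet> z)\<^sup>2)) y)"
  have "?g *v v = (v \<bullet> ?l / N y + b \<bullet> v) *\<^sub>R (?l /\<^sub>R N y + b) +
    (N y + b \<bullet> y) *\<^sub>R ((a *v v) /\<^sub>R N y - ((v \<bullet> ?l) / N y ^ 3) *\<^sub>R ?l)"
  proof (rule vec_eq_iff[THEN iffD2], rule allI)
    fix i
    \<comment> \<open>\<open>expand\<close> isolates what depends on the summation index in one
      summand; \<open>collect\<close> pulls the remaining factors out of the sum.\<close>
    have expand: "(A * (l / c + d) + B * (s / c - k * l / K)) * x =
      A * (x * l / c + d * x) + B * (s * x / c - k / K * (x * l))" for A B c d k l s x K :: real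
      by (simp add: divide_inverse algebra_simps)
    have collect: "(\<Sum>j\<in>UNIV. A * (f j / c + h j) + B * (k j / c - K * f j)) =
      A * (sum f UNIV / c + sum h UNIV) + B * (sum k UNIV / c - K * sum f UNIV)"
      for A B c K :: real and f h k :: "'n \<Rightarrow> real"
      by (simp add: sum.distrib sum_subtractf distrib_left right_diff_distrib
          flip: sum_distrib_left sum_divide_distrib)
    note entry = randers_hessian_entry[OF a y, where b = b,
        folded fun_cong[OF N_def[THEN meta_eq_to_obj_eq]]]
    have "(?g *v v) $ i = (\<Sum>j\<in>UNIV. (?l $ i / N y + b $ i) * (v $ j * ?l $ j / N y + b $ j * v $ j) +
      (N y + b \<bullet> y) * (a $ i $ j * v $ j / N y - ?l $ i / N y ^ 3 * (v $ j * ?l $ j)))"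
      unfolding matrix_vector_mult_def[of ?g]
      unfolding vec_lambda_beta entry
      by (intro sum.cong refl) (rule expand)
    also have "\<dots> = (?l $ i / N y + b $ i) * ((v \<bullet> ?l) / N y + b \<bullet> v) +
      (N y + b \<bullet> y) * ((a *v v) $ i / N y - ?l $ i / N y ^ 3 * (v \<bullet> ?l))"
      unfolding collect inner_vec_def[of v] inner_vec_def[of b v] matrix_vector_mult_def[of a v]
        inner_real_def vec_lambda_beta ..
    finally show "(?g *v v) $ i = ((v \<bullet> ?l / N y + b \<bullet> v) *\<^sub>R (?l /\<^sub>R N y + b) +
      (N y + b \<bullet> y) *\<^sub>R ((a *v v) /\<^sub>R N y - ((v \<bullet> ?l) / N y ^ 3) *\<^sub>R ?l)) $ i"
      by (simp only: vector_add_component vector_minus_component vector_scaleR_component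
          real_scaleR_def divide_inverse mult_ac)
  qed
  then have "u \<bullet> (?g *v v) = (v \<bullet> ?l / N y + b \<bullet> v) * (u \<bullet> ?l / N y + b \<bullet> u) +
    (N y + b \<bullet> y) * (u \<bullet> (a *v v) / N y - (v \<bullet> ?l) / N y ^ 3 * (u \<bullet> ?l))"
    by (simp only: inner_add_right inner_diff_right inner_scaleR_right inner_commute[of u b]
        divide_inverse_commute)
  then show ?thesis
    by (simp only: divide_inverse mult_ac)
qed

section \<open>Tangent vectors in induced coordinates\<close>

lemma smooth_on_imp_differentiable:
  assumes "smooth_on S f" "x \<in> S"
  shows "f differentiable at x"
  using assms unfolding smooth_on_def by (metis Ck_on.simps(2))

context
  fixes M :: "'m topology" and A :: "('m, 'n::finite) chart set"
  assumes M: "smooth_manifold M A"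
begin

lemma chart_inj: "c \<in> A \<Longrightarrow> inj_on (snd c) (fst c)"
  using M unfolding smooth_manifold_def
  by (metis homeomorphic_imp_injective_map openin_subset topspace_subtopology_subset)

lemma chart_inv_chart: "c \<in> A \<Longrightarrow> p \<in> fst c \<Longrightarrow> chart_inv c (snd c p) = p"
  using chart_inj by (simp add: chart_inv_def)

lemma open_chart_overlap:
  assumes "c \<in> A" "d \<in> A"
  shows "open (snd c ` (fst c \<inter> fst d))"
proof -
  have o: "openin M (fst c)" "openin M (fst d)" "open (chart_image c)"
    and h: "homeomorphic_map (subtopology M (fst c)) (top_of_set (chart_image c)) (snd c)"
    using M assms unfolding smooth_manifold_def by auto
  have "openin (subtopology M (fst c)) (fst c \<inter> fst d)"
    using o by (simp add: openin_subtopology_Int2)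
  then have "openin (top_of_set (chart_image c)) (snd c ` (fst c \<inter> fst d))"
    using homeomorphic_map_openness_eq[OF h] by blast
  then show ?thesis
    using o(3) openin_open_trans by blast
qed

lemma transition_differentiable:
  assumes "c \<in> A" "d \<in> A" "p \<in> fst c" "p \<in> fst d"
  shows "transition c d differentiable at (snd c p)"
  using M assms unfolding smooth_manifold_def
  by (intro smooth_on_imp_differentiable[where S = "snd c ` (fst c \<inter> fst d)"]) auto

text \<open>The chain rule, giving the cocycle law of the Jacobians. It is what makes the components
  in \<open>tangent_at\<close> compatible across charts.\<close>

lemma frechet_derivative_transition_compose:
  assumes "c \<in> A" "d \<in> A" "d' \<in> A" "p \<in> fst c" "p \<in> fst d" "p \<in> fst d'"
  shows "frechet_derivative (transition c d') (at (snd c p)) y =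
    frechet_derivative (transition d d') (at (snd d p))
      (frechet_derivative (transition c d) (at (snd c p)) y)"
proof -
  let ?S = "snd c ` (fst c \<inter> fst d)"
  have cd: "transition c d (snd c p) = snd d p"
    using assms by (simp add: transition_def chart_inv_chart)
  have "frechet_derivative (transition c d') (at (snd c p)) =
    frechet_derivative (transition d d' \<circ> transition c d) (at (snd c p))"
  proof (rule frechet_derivative_transform_within_open[where X = ?S])
    show "transition c d' differentiable at (snd c p)"
      using assms by (intro transition_differentiable)
    show "open ?S"
      using assms by (intro open_chart_overlap)
    \<comment> \<open>Coordinate maps are total functions, so both sides equal \<open>snd d'\<close>
      of the same point on all of \<open>?S\<close>.\<close>
    show "transition c d' x = (transition d d' \<circ> transition c d) x" if "x \<in> ?S" for x
      using that assms by (auto simp: transition_def chart_inv_chart)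
  qed (use assms in auto)
  also have "\<dots> = frechet_derivative (transition d d') (at (transition c d (snd c p))) \<circ>
      frechet_derivative (transition c d) (at (snd c p))"
    using assms cd by (intro frechet_derivative_compose) (simp_all add: transition_differentiable)
  finally show ?thesis
    by (simp add: cd)
qed

text \<open>Compatibility of the components is the cocycle law; for charts not around the base point
  both definitions prescribe 0.\<close>

lemma tangent_at_in_tangent_bundle:
  assumes "c \<in> A" "x \<in> chart_image c"
  shows "tangent_at A c x y \<in> tangent_bundle M A"
proof -
  obtain p where p: "p \<in> fst c" "x = snd c p"
    using assms(2) unfolding chart_image_def by blast
  have "p \<in> topspace M"
    using M assms(1) p(1) unfolding smooth_manifold_def by blast
  moreover have "snd (tangent_at A c x y) \<in> tangent_space A p"
  proof -
    let ?v = "snd (tangent_at A c x y)"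
    have v: "?v d = (if d \<in> A \<and> p \<in> fst d
        then frechet_derivative (transition c d) (at (snd c p)) y else 0)" for d
      unfolding tangent_at_def p(2) chart_inv_chart[OF assms(1) p(1)] snd_conv ..
    have "?v d' = frechet_derivative (transition d d') (at (snd d p)) (?v d)"
      if "d \<in> A" "d' \<in> A" "p \<in> fst d \<inter> fst d'" for d d'
    proof -
      have d: "p \<in> fst d" "p \<in> fst d'"
        using that by auto
      show ?thesis
        using frechet_derivative_transition_compose[OF assms(1) that(1,2) p(1) d]
        unfolding v using that d by (simp only: if_True simp_thms)
    qed
    moreover have "?v d = 0" if "\<not> (d \<in> A \<and> p \<in> fst d)" for d
      unfolding v using that by (simp only: if_False)
    ultimately show ?thesis
      unfolding tangent_space_def by blast
  qed
  moreover have "fst (tangent_at A c x y) = p"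
    unfolding tangent_at_def p(2) chart_inv_chart[OF assms(1) p(1)] by simp
  ultimately show ?thesis
    unfolding tangent_bundle_def by (metis SigmaI prod.collapse)
qed

text \<open>The components in one chart around the base point determine all others, so a vector with
  \<beta> nonzero can be written in coordinates.\<close>

lemma tangent_bundle_eq_tangent_at:
  assumes "v \<in> tangent_bundle M A"
  shows "\<exists>c\<in>A. \<exists>x\<in>chart_image c. \<exists>y. v = tangent_at A c x y"
proof -
  obtain c where c: "c \<in> A" "fst v \<in> fst c"
  proof -
    have "fst v \<in> (\<Union>c\<in>A. fst c)"
      using assms M unfolding tangent_bundle_def smooth_manifold_def by auto
    then show thesis
      using that by blast
  qed
  have v: "snd v \<in> tangent_space A (fst v)"
    using assms unfolding tangent_bundle_def by (cases v) simp
  have *: "snd v d = (if d \<in> A \<and> fst v \<in> fst d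
      then frechet_derivative (transition c d) (at (snd c (fst v))) (snd v c) else 0)" for d
  proof (cases "d \<in> A \<and> fst v \<in> fst d")
    case True
    then have "snd v d = frechet_derivative (transition c d) (at (snd c (fst v))) (snd v c)"
      using v c unfolding tangent_space_def by blast
    with True show ?thesis
      by (simp only: if_True simp_thms)
  next
    case False
    then have "snd v d = 0"
      using v unfolding tangent_space_def by blast
    with False show ?thesis
      by (simp only: if_False)
  qed
  have "v = tangent_at A c (snd c (fst v)) (snd v c)"
  proof (rule prod_eqI)
    show "fst v = fst (tangent_at A c (snd c (fst v)) (snd v c))"
      by (simp add: tangent_at_def chart_inv_chart[OF c])
    show "snd v = snd (tangent_at A c (snd c (fst v)) (snd v c))"
      unfolding tangent_at_def chart_inv_chart[OF c] snd_conv by (rule ext) (rule *)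
  qed
  then show ?thesis
    using c unfolding chart_image_def by blast
qed

end

section \<open>The contradiction in a single tangent space\<close>

text \<open>With the base point fixed, \<eta> is just an unknown scalar common to all entries, and
  \<open>rat\<close> records rationality along lines that miss the origin.\<close>

lemma randers_not_ar_at_point:
  fixes a :: "real ^ 'n ^ 'n" and b :: "real ^ 'n"
    and \<eta> :: "real ^ 'n \<Rightarrow> real" and r :: "real ^ 'n \<Rightarrow> real ^ 'n ^ 'n"
  assumes a: "sym_pos_def a" and b: "b \<noteq> 0" and n: "CARD('n) \<ge> 2"
    and g: "\<And>y. y \<noteq> 0 \<Longrightarrow>
      (\<chi> i j. 1 / 2 * partial_deriv i (partial_deriv j (\<lambda>z. (sqrt (z \<bullet> (a *v z)) + b \<bullet> z)\<^sup>2)) y) =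
      \<eta> y *\<^sub>R r y"
    and rat: "\<And>e w i j. (\<And>t. e + t *\<^sub>R w \<noteq> 0) \<Longrightarrow>
      rational_fun (\<lambda>t. r (e + t *\<^sub>R w) $ i $ j)"
  shows False
proof -
  obtain w where w: "a *v w = b"
    using sym_pos_def_surj[OF a] by blast
  obtain e where e: "e \<noteq> 0" "e \<bullet> b = 0"
    using orthogonal_to_vector_exists[of b] n by (auto simp: orthogonal_def inner_commute)
  have sym: "u \<bullet> (a *v v) = v \<bullet> (a *v u)" for u v
    using a by (intro inner_matrix_vector_sym) (simp add: sym_pos_def_def)
  have pos: "v \<bullet> (a *v v) > 0" if "v \<noteq> 0" for v
    using a that by (simp add: sym_pos_def_def)
  define m where "m = b \<bullet> w"
  define q where "q = e \<bullet> (a *v e)"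
  have "w \<noteq> 0"
    using w b by auto
  then have m: "m > 0"
    using pos[of w] w by (simp add: m_def inner_commute)
  have q: "q > 0"
    using pos[OF e(1)] by (simp add: q_def)
  have wae: "w \<bullet> (a *v e) = 0" and waw: "w \<bullet> (a *v w) = m" and eaw: "e \<bullet> (a *v w) = 0"
    and be: "b \<bullet> e = 0"
    using sym[of w e] w e(2) by (simp_all add: m_def inner_commute)
  \<comment> \<open>Pairing a point of the line with \<open>e\<close> under \<open>a\<close> always
    gives \<open>q > 0\<close>, since \<open>e\<close> and \<open>w\<close> are
    \<open>a\<close>-orthogonal.\<close>
  have y0: "e + t *\<^sub>R w \<noteq> 0" for t
  proof
    assume "e + t *\<^sub>R w = 0"
    then have "e \<bullet> (a *v (e + t *\<^sub>R w)) = 0"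
      by simp
    then show False
      using q eaw by (simp add: matrix_vector_right_distrib matrix_vector_mult_scaleR inner_add_right q_def)
  qed
  define N where "N = (\<lambda>t. sqrt (q + m * t\<^sup>2))"
  have N2: "(N t)\<^sup>2 = q + m * t\<^sup>2" and N0: "N t > 0" for t
    using q m by (simp_all add: N_def add_pos_nonneg)
  have y: "e \<bullet> (a *v (e + t *\<^sub>R w)) = q" "w \<bullet> (a *v (e + t *\<^sub>R w)) = t * m"
    "b \<bullet> (e + t *\<^sub>R w) = t * m"
    "sqrt ((e + t *\<^sub>R w) \<bullet> (a *v (e + t *\<^sub>R w))) = N t" for t
    using wae waw eaw be
    by (simp_all add: matrix_vector_right_distrib matrix_vector_mult_scaleR inner_add_right
        inner_add_left q_def m_def N_def power2_eq_square mult_ac)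
  have ee: "\<eta> (e + t *\<^sub>R w) * (e \<bullet> (r (e + t *\<^sub>R w) *v e)) = q * (N t ^ 3 + m\<^sup>2 * t ^ 3) / N t ^ 3" for t
  proof -
    have "\<eta> (e + t *\<^sub>R w) * (e \<bullet> (r (e + t *\<^sub>R w) *v e)) =
        (q / N t) * (q / N t) + (N t + t * m) * (q / N t - q * q / N t ^ 3)"
      using inner_randers_hessian[OF a y0[of t], of e b e, unfolded g[OF y0] y be q_def[symmetric]]
      by (simp add: scaleR_matrix_vector_assoc[symmetric])
    \<comment> \<open>The two terms \<open>q\<^sup>2 / (N t)\<^sup>2\<close> cancel. Then
      \<open>N2\<close> turns \<open>(N t)\<^sup>2 - q\<close> into
      \<open>m * t\<^sup>2\<close>.\<close>
    also have "\<dots> = q * (N t ^ 3 + m * t * ((N t)\<^sup>2 - q)) / N t ^ 3"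
      using N0[of t] by (simp add: field_simps power2_eq_square power3_eq_cube)
    also have "m * t * ((N t)\<^sup>2 - q) = m\<^sup>2 * t ^ 3"
      unfolding N2 by (simp add: power2_eq_square power3_eq_cube)
    finally show ?thesis .
  qed
  have ew: "\<eta> (e + t *\<^sub>R w) * (e \<bullet> (r (e + t *\<^sub>R w) *v w)) = q\<^sup>2 * m / N t ^ 3" for t
  proof -
    have "\<eta> (e + t *\<^sub>R w) * (e \<bullet> (r (e + t *\<^sub>R w) *v w)) =
        (q / N t) * (t * m / N t + m) + (N t + t * m) * (0 / N t - q * (t * m) / N t ^ 3)"
      using inner_randers_hessian[OF a y0[of t], of e b w, unfolded g[OF y0] y be eaw m_def[symmetric]]
      by (simp add: scaleR_matrix_vector_assoc[symmetric])
    also have "\<dots> = q * m * ((N t)\<^sup>2 - m * t\<^sup>2) / N t ^ 3"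
      using N0[of t] by (simp add: field_simps power2_eq_square power3_eq_cube)
    finally show ?thesis
      unfolding N2 by (simp add: power2_eq_square mult_ac)
  qed
  have rf: "rational_fun (\<lambda>t. u \<bullet> (r (e + t *\<^sub>R w) *v v))" for u v
    unfolding inner_matrix_vector_mult
    by (intro rational_fun_sum rational_fun_mult rational_fun_const rat y0)
  obtain P1 D1 where ree: "\<And>t. poly D1 t \<noteq> 0 \<and> e \<bullet> (r (e + t *\<^sub>R w) *v e) = poly P1 t / poly D1 t"
    using rf unfolding rational_fun_def by blast
  obtain P2 D2 where rew: "\<And>t. poly D2 t \<noteq> 0 \<and> e \<bullet> (r (e + t *\<^sub>R w) *v w) = poly P2 t / poly D2 t"
    using rf unfolding rational_fun_def by blast
  \<comment> \<open>The value in \<open>ew\<close> never vanishes, so neither factor does: \<eta>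
    can be cancelled, and \<open>P2\<close> can serve in a denominator.\<close>
  have \<eta>0: "\<eta> (e + t *\<^sub>R w) \<noteq> 0" and P2: "poly P2 t \<noteq> 0" for t
  proof -
    have "q\<^sup>2 * m / N t ^ 3 \<noteq> 0"
      using q m N0[of t] by simp
    then show "\<eta> (e + t *\<^sub>R w) \<noteq> 0" "poly P2 t \<noteq> 0"
      using ew[of t] rew[of t] by auto
  qed
  \<comment> \<open>Clearing denominators in the quotient of \<open>ee\<close> by \<open>ew\<close>
    gives \<open>(N^3 + m^2 t^3) P2 D1 = q m P1 D2\<close>. Splitting \<open>N^3\<close> as
    \<open>N (q + m t^2)\<close> and isolating \<open>N\<close> yields
    \<open>N X = Y\<close>.\<close>
  define X where "X = [:q, 0, m:] * P2 * D1"
  define Y where "Y = smult (q * m) (P1 * D2) - monom (m\<^sup>2) 3 * P2 * D1"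
  have "poly X 0 \<noteq> 0"
    using P2 ree q by (simp add: X_def)
  then have "X \<noteq> 0"
    by auto
  moreover have "N t * poly X t = poly Y t" for t
  proof -
    \<comment> \<open>Cross-multiplied form of the quotient, with the common factor \<eta> kept on
      both sides until it is cancelled.\<close>
    have "\<eta> (e + t *\<^sub>R w) * ((N t ^ 3 + m\<^sup>2 * t ^ 3) * (e \<bullet> (r (e + t *\<^sub>R w) *v w))) =
        (N t ^ 3 + m\<^sup>2 * t ^ 3) * (q\<^sup>2 * m / N t ^ 3)"
      unfolding ew[of t, symmetric] by (simp only: mult_ac)
    also have "\<dots> = q * m * (q * (N t ^ 3 + m\<^sup>2 * t ^ 3) / N t ^ 3)"
      by (simp add: power2_eq_square)
    also have "\<dots> = \<eta> (e + t *\<^sub>R w) * (q * m * (e \<bullet> (r (e + t *\<^sub>R w) *v e)))"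
      unfolding ee[of t, symmetric] by (simp only: mult_ac)
    finally have "(N t ^ 3 + m\<^sup>2 * t ^ 3) * (e \<bullet> (r (e + t *\<^sub>R w) *v w)) =
        q * m * (e \<bullet> (r (e + t *\<^sub>R w) *v e))"
      using \<eta>0[of t] by simp
    then have "(N t ^ 3 + m\<^sup>2 * t ^ 3) * (poly P2 t * poly D1 t) = q * m * (poly P1 t * poly D2 t)"
      using ree[of t] rew[of t] by (simp add: field_simps)
    moreover have "poly X t = (N t)\<^sup>2 * (poly P2 t * poly D1 t)"
      unfolding N2 by (simp add: X_def power2_eq_square algebra_simps)
    ultimately show ?thesis
      by (simp add: Y_def poly_monom algebra_simps power2_eq_square power3_eq_cube)
  qed
  ultimately show False
    using sqrt_quadratic_not_rational[OF q m] unfolding N_def by blast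
qed

section \<open>Reduction from the manifold to one fibre\<close>

theorem theorem3p25:
  fixes M :: "'m topology"
    and A :: "('m, 'n::finite) chart set"
    and F \<alpha> \<beta> :: "('m, 'n) tangent \<Rightarrow> real"
  assumes "smooth_manifold M A"
    and "CARD('n) \<ge> 2"
    and "randers_metric M A F \<alpha> \<beta>"
    and "\<exists>v\<in>tangent_bundle M A. \<beta> v \<noteq> 0"
  shows "\<not> ar_finsler_metric M A F"
proof
  assume ar: "ar_finsler_metric M A F"
  obtain c x y where c: "c \<in> A" and x: "x \<in> chart_image c"
    and \<beta>: "\<beta> (tangent_at A c x y) \<noteq> 0"
    using assms(4) tangent_bundle_eq_tangent_at[OF assms(1)] by metis
  obtain a b where a: "riemannian_coeffs A c \<alpha> a" and b: "one_form_coeffs A c \<beta> b"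
    using assms(3) c unfolding randers_metric_def by blast
  have b_inner: "\<beta> (tangent_at A c x z) = b x \<bullet> z" for z
    using b x unfolding one_form_coeffs_def by (simp add: inner_vec_def)
  \<comment> \<open>The splitting of \<open>F\<close> is given on the tangent bundle, where
    \<open>tangent_at\<close> takes its values. The formula holds for every \<open>z\<close> in the
    fibre, so it may be substituted under both derivatives of the fundamental tensor.\<close>
  have F: "F (tangent_at A c x z) = sqrt (z \<bullet> (a x *v z)) + b x \<bullet> z" for z
  proof -
    have "F (tangent_at A c x z) = \<alpha> (tangent_at A c x z) + \<beta> (tangent_at A c x z)"
      using assms(3) tangent_at_in_tangent_bundle[OF assms(1) c x]
      unfolding randers_metric_def by blast
    then show ?thesis
      using a x unfolding riemannian_coeffs_def by (simp add: b_inner inner_matrix_vector_mult)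
  qed
  obtain \<eta> r where r: "\<And>y. y \<noteq> 0 \<Longrightarrow> fundamental_tensor A F c x y = \<eta> (tangent_at A c x y) *\<^sub>R r x y"
    and rat: "\<And>i j. rational_in_fibre (chart_image c) (\<lambda>x y. r x y $ i $ j)"
    using ar c x unfolding ar_finsler_metric_def by metis
  show False
  proof (rule randers_not_ar_at_point[where a = "a x" and b = "b x" and r = "r x"
        and \<eta> = "\<lambda>y. \<eta> (tangent_at A c x y)"])
    show "sym_pos_def (a x)"
      using a x unfolding riemannian_coeffs_def by blast
    show "b x \<noteq> 0"
      using \<beta> b_inner by auto
    show "(\<chi> i j. 1 / 2 * partial_deriv i (partial_deriv j
        (\<lambda>z. (sqrt (z \<bullet> (a x *v z)) + b x \<bullet> z)\<^sup>2)) y) = \<eta> (tangent_at A c x y) *\<^sub>R r x y"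
      if "y \<noteq> 0" for y
      using r[OF that] unfolding fundamental_tensor_def F .
    show "rational_fun (\<lambda>t. r x (e + t *\<^sub>R w) $ i $ j)" if "\<And>t. e + t *\<^sub>R w \<noteq> 0" for e w i j
      using rational_in_fibre_line[OF rat x that] .
  qed (use assms(2) in simp)
qed

end
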